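(* Let $|q|<1$, $|\beta|<1$ and $|x|<\frac{2}{\sqrt{1-q}}$. Then $$f_R(x|\beta,q)=f_N(x|q)\sum_{k=0}^{\infty}\frac{\beta^k}{[k]_q!\,(\beta q)_k}\,H_{2k}(x|q).$$
   Context: Notation: $[0]_q=0$, $[n]_q=1+q+\dots+q^{n-1}$, $[n]_q!=\prod_{i=1}^n[i]_q$, $[0]_q!=1$; $(a)_n=\prod_{i=0}^{n-1}(1-aq^i)$, $(a)_0=1$, $(a)_\infty=\prod_{i\ge0}(1-aq^i)$; $0^0=1$. The densities are $$f_N(x|q)=\frac{\sqrt{1-q}\,(q)_\infty}{2\pi\sqrt{4-(1-q)x^2}}\prod_{k=0}^\infty\left((1+q^k)^2-(1-q)x^2q^k\right),$$ $$f_R(x|\beta,q)=\frac{\sqrt{1-q}\,(\beta^2)_\infty(q)_\infty}{2\pi\sqrt{4-(1-q)x^2}\,(\beta)_\infty(\beta q)_\infty}\prod_{k=0}^\infty\frac{(1+q^k)^2-(1-q)x^2q^k}{(1+\beta q^k)^2-(1-q)\beta x^2q^k}.$$ $q$-Hermite polynomials: $H_{-1}(x|q)=0$, $H_0(x|q)=1$, $H_{n+1}(x|q)=xH_n(x|q)-[n]_qH_{n-1}(x|q)$. *)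

theory Defs
  imports "HOL-Analysis.Analysis"
begin

definition qnum :: "real \<Rightarrow> nat \<Rightarrow> real" where
  "qnum q n = (\<Sum>i<n. q ^ i)"

definition qfact :: "real \<Rightarrow> nat \<Rightarrow> real" where
  "qfact q n = (\<Prod>i=1..n. qnum q i)"

definition qpoch :: "real \<Rightarrow> real \<Rightarrow> nat \<Rightarrow> real" where
  "qpoch a q n = (\<Prod>i<n. 1 - a * q ^ i)"

definition qpoch_inf :: "real \<Rightarrow> real \<Rightarrow> real" where
  "qpoch_inf a q = (\<Prod>i. 1 - a * q ^ i)"

(* Three-term recurrence H_{n+1} = x H_n - [n]_q H_{n-1} with H_{-1} = 0, H_0 = 1;
   its instance n = 0 gives the second equation. *)
fun qHermite :: "nat \<Rightarrow> real \<Rightarrow> real \<Rightarrow> real" where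
  "qHermite 0 x q = 1"
| "qHermite (Suc 0) x q = x"
| "qHermite (Suc (Suc n)) x q =
     x * qHermite (Suc n) x q - qnum q (Suc n) * qHermite n x q"

definition f_N :: "real \<Rightarrow> real \<Rightarrow> real" where
  "f_N x q =
     sqrt (1 - q) * qpoch_inf q q / (2 * pi * sqrt (4 - (1 - q) * x\<^sup>2)) *
     (\<Prod>k. (1 + q ^ k)\<^sup>2 - (1 - q) * x\<^sup>2 * q ^ k)"

definition f_R :: "real \<Rightarrow> real \<Rightarrow> real \<Rightarrow> real" where
  "f_R x \<beta> q =
     sqrt (1 - q) * qpoch_inf (\<beta>\<^sup>2) q * qpoch_inf q q /
       (2 * pi * sqrt (4 - (1 - q) * x\<^sup>2) * qpoch_inf \<beta> q * qpoch_inf (\<beta> * q) q) *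
     (\<Prod>k. ((1 + q ^ k)\<^sup>2 - (1 - q) * x\<^sup>2 * q ^ k) /
          ((1 + \<beta> * q ^ k)\<^sup>2 - (1 - q) * \<beta> * x\<^sup>2 * q ^ k))"

end

(* Rescale h n = sqrt (1 - q) ^ n * H_n, so that (1 - q) ^ k * [k]_q! = (q)_k turns the series into
   G b = (SUM k. b ^ k * h (2 k) / ((q)_k (b q)_k)). Eliminating the odd indices from the recurrence
   of h yields the functional equation
     ((1 + b)^2 - (1 - q) b x^2) G b = (1 + b) (1 - b^2 q) / (1 - b q) * G (b q).
   Since h is bounded, G converges for |b| < 1 and G (b q ^ n) tends to 1; iterating the equation
   therefore expresses G b as the product of the factors, which is the quotient of the densities. *)

theory Submission
  imports Defs
begin

section \<open>q-Pochhammer products: convergence, nonvanishing and a uniform lower bound\<close>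

lemma qpoch_Suc: "qpoch a q (Suc n) = qpoch a q n * (1 - a * q ^ n)"
  by (simp add: qpoch_def)

lemma qpoch_Suc_shift: "qpoch a q (Suc n) = (1 - a) * qpoch (a * q) q n"
  by (simp add: qpoch_def prod.lessThan_Suc_shift mult.assoc del: prod.lessThan_Suc)

lemma abs_mult_power_less_1:
  fixes a q :: real
  assumes "\<bar>a\<bar> < 1" "\<bar>q\<bar> < 1"
  shows "\<bar>a * q ^ n\<bar> < 1"
proof -
  have "\<bar>a * q ^ n\<bar> \<le> \<bar>a\<bar> * 1"
    unfolding abs_mult power_abs using assms by (intro mult_left_mono power_le_one) auto
  then show ?thesis using assms by simp
qed

lemma one_minus_mult_power_neq_0:
  fixes a q :: real
  assumes "\<bar>a\<bar> < 1" "\<bar>q\<bar> < 1"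
  shows "1 - a * q ^ n \<noteq> 0"
  using abs_mult_power_less_1[OF assms, of n] by auto

lemma qpoch_neq_0:
  assumes "\<bar>a\<bar> < 1" "\<bar>q\<bar> < 1"
  shows "qpoch a q n \<noteq> 0"
  using one_minus_mult_power_neq_0[OF assms] by (simp add: qpoch_def)

text \<open>Every infinite product met below has factors quadratic in \<open>q ^ n\<close> with
  constant term 1. The deviation from 1 is dominated by a geometric series, so convergence is
  absolute.\<close>

lemma convergent_prod_one_plus_quadratic_power:
  fixes q :: real
  assumes q: "\<bar>q\<bar> < 1"
  shows "convergent_prod (\<lambda>n. 1 + (u * q ^ n + v * (q ^ n)\<^sup>2))"
proof -
  have bound: "\<bar>u * q ^ n + v * (q ^ n)\<^sup>2\<bar> \<le> (\<bar>u\<bar> + \<bar>v\<bar>) * \<bar>q\<bar> ^ n" for n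
  proof -
    have "\<bar>v * (q ^ n)\<^sup>2\<bar> = \<bar>v\<bar> * \<bar>q\<bar> ^ n * \<bar>q\<bar> ^ n"
      by (simp add: abs_mult power_abs power2_eq_square)
    also have "\<dots> \<le> \<bar>v\<bar> * \<bar>q\<bar> ^ n * 1"
      using q by (intro mult_left_mono power_le_one) auto
    finally show ?thesis
      using abs_triangle_ineq[of "u * q ^ n" "v * (q ^ n)\<^sup>2"]
      by (simp add: abs_mult power_abs distrib_right)
  qed
  have "summable (\<lambda>n. (\<bar>u\<bar> + \<bar>v\<bar>) * \<bar>q\<bar> ^ n)"
    using q by (intro summable_mult summable_geometric) simp
  then have "summable (\<lambda>n. norm (u * q ^ n + v * (q ^ n)\<^sup>2))"
    by (rule summable_comparison_test'[where N = 0]) (simp add: bound)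
  then show ?thesis
    by (intro abs_convergent_prod_imp_convergent_prod summable_imp_abs_convergent_prod)
      simp
qed

lemma convergent_prod_qpoch:
  fixes q :: real
  assumes "\<bar>q\<bar> < 1"
  shows "convergent_prod (\<lambda>n. 1 - a * q ^ n)"
  using convergent_prod_one_plus_quadratic_power[OF assms, of "- a" 0] by simp

lemma qpoch_tendsto:
  assumes "\<bar>q\<bar> < 1"
  shows "(\<lambda>n. qpoch a q n) \<longlonglongrightarrow> qpoch_inf a q"
  using has_prod_imp_tendsto'[OF convergent_prod_has_prod[OF convergent_prod_qpoch[OF assms]]]
  unfolding qpoch_def qpoch_inf_def .

lemma qpoch_inf_neq_0:
  assumes "\<bar>a\<bar> < 1" "\<bar>q\<bar> < 1"
  shows "qpoch_inf a q \<noteq> 0"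
  unfolding qpoch_inf_def
  by (rule prodinf_nonzero[OF convergent_prod_qpoch[OF assms(2)]])
    (rule one_minus_mult_power_neq_0[OF assms])

text \<open>A single \<open>c\<close> serves \<open>a = q\<close> and all \<open>a = b * q\<close>
  with |b| < 1. Factor by factor, the worst case is the product with |q| as both parameter and base;
  its partial products decrease to a limit that is nonzero, hence positive.\<close>

lemma qpoch_uniform_lower_bound:
  fixes q :: real
  assumes q: "\<bar>q\<bar> < 1"
  obtains c where "c > 0" "\<And>a k. \<bar>a\<bar> \<le> \<bar>q\<bar> \<Longrightarrow> c \<le> \<bar>qpoch a q k\<bar>"
proof
  let ?P = "qpoch \<bar>q\<bar> \<bar>q\<bar>" and ?c = "qpoch_inf \<bar>q\<bar> \<bar>q\<bar>"
  have lt: "\<bar>q\<bar> * \<bar>q\<bar> ^ i < 1" for i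
    using abs_mult_power_less_1[of "\<bar>q\<bar>" "\<bar>q\<bar>" i] q by simp
  have pos: "?P k > 0" for k unfolding qpoch_def using lt by (intro prod_pos) auto
  have lim: "?P \<longlonglongrightarrow> ?c" using q by (intro qpoch_tendsto) simp
  have "decseq ?P"
    by (rule decseq_SucI) (use pos in \<open>auto simp: qpoch_Suc mult_le_cancel_left1 less_le\<close>)
  then have le: "?c \<le> ?P k" for k using lim by (rule decseq_ge)
  have "0 \<le> ?c" using lim by (rule LIMSEQ_le_const) (use pos less_imp_le in blast)
  then show "0 < ?c" using qpoch_inf_neq_0[of "\<bar>q\<bar>" "\<bar>q\<bar>"] q by simp
  fix a :: real and k
  assume a: "\<bar>a\<bar> \<le> \<bar>q\<bar>"
  have "1 - \<bar>q\<bar> * \<bar>q\<bar> ^ i \<le> \<bar>1 - a * q ^ i\<bar>" for i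
  proof -
    have "\<bar>a * q ^ i\<bar> \<le> \<bar>q\<bar> * \<bar>q\<bar> ^ i"
      unfolding abs_mult power_abs using a by (intro mult_right_mono) auto
    then show ?thesis by linarith
  qed
  then have "?P k \<le> \<bar>qpoch a q k\<bar>"
    unfolding qpoch_def abs_prod using lt by (intro prod_mono) (auto intro: less_imp_le)
  then show "?c \<le> \<bar>qpoch a q k\<bar>" using le[of k] by linarith
qed

section \<open>Boundedness of solutions of the rescaled recurrence\<close>

text \<open>
  \<open>E n = (h n)\<^sup>2 - y h n h (n+1) + (h (n+1))\<^sup>2\<close> is invariant under the recurrence without the \<open>q\<close>-term and
  positive definite because \<open>\<bar>y\<bar> < 2\<close>; the \<open>q\<close>-term changes it by a factor \<open>1 + O(q ^ n)\<close> only.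
\<close>

lemma perturbed_Chebyshev_recurrence_bounded:
  fixes h :: "nat \<Rightarrow> real"
  assumes rec: "\<And>n. h (Suc (Suc n)) = y * h (Suc n) - (1 - q ^ Suc n) * h n"
    and y: "\<bar>y\<bar> < 2" and q: "\<bar>q\<bar> < 1"
  obtains M where "\<And>n. \<bar>h n\<bar> \<le> M"
proof -
  define E where "E n = (h n)\<^sup>2 - y * h n * h (Suc n) + (h (Suc n))\<^sup>2" for n
  \<comment> \<open>The smaller eigenvalue of the quadratic form
    \<open>u\<^sup>2 - y * u * v + v\<^sup>2\<close>, whose eigenvalues are 1 + y/2 and 1 -
    y/2.\<close>
  define d where "d = 1 - \<bar>y\<bar> / 2"
  have d: "d > 0" using y by (simp add: d_def)
  have two: "2 * \<bar>u * v\<bar> \<le> u\<^sup>2 + v\<^sup>2" for u v :: real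
    using sum_squares_bound[of "\<bar>u\<bar>" "\<bar>v\<bar>"] by (simp add: abs_mult)
  have E_ge: "d * ((h n)\<^sup>2 + (h (Suc n))\<^sup>2) \<le> E n" for n
  proof -
    have "y * h n * h (Suc n) \<le> \<bar>y\<bar> * \<bar>h n * h (Suc n)\<bar>"
      unfolding abs_mult[symmetric] mult.assoc by (rule abs_ge_self)
    also have "\<dots> \<le> \<bar>y\<bar> * (((h n)\<^sup>2 + (h (Suc n))\<^sup>2) / 2)"
      using two[of "h n" "h (Suc n)"] by (intro mult_left_mono) auto
    finally show ?thesis by (simp add: E_def d_def algebra_simps add_divide_distrib)
  qed
  have E_step: "E (Suc n) \<le> (1 + 4 / d * \<bar>q\<bar> ^ Suc n) * E n" for n
  proof -
    define e u v where "e = q ^ Suc n" and "u = h n" and "v = h (Suc n)"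
    have e: "\<bar>e\<bar> \<le> 1" unfolding e_def power_abs using q by (intro power_le_one) auto
    \<comment> \<open>The new value is \<open>(y * v - u) + e * u\<close>. The first part alone
      preserves \<open>E\<close>, so the whole change carries a factor \<open>e\<close>.\<close>
    have "E (Suc n) = E n + e * (y * (u * v) - 2 * u\<^sup>2 + e * u\<^sup>2)"
      unfolding E_def rec e_def[symmetric] u_def[symmetric] v_def[symmetric]
      by (simp add: power2_eq_square algebra_simps)
    also have "\<dots> \<le> E n + \<bar>e\<bar> * \<bar>y * (u * v) - 2 * u\<^sup>2 + e * u\<^sup>2\<bar>"
      unfolding abs_mult[symmetric] by (intro add_left_mono abs_ge_self)
    \<comment> \<open>A crude constant: the three terms contribute at most
      \<open>u\<^sup>2 + v\<^sup>2\<close>, \<open>2 * u\<^sup>2\<close> and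
      \<open>u\<^sup>2\<close>.\<close>
    also have "\<bar>y * (u * v) - 2 * u\<^sup>2 + e * u\<^sup>2\<bar> \<le> 4 * (u\<^sup>2 + v\<^sup>2)"
    proof -
      have "\<bar>y * (u * v)\<bar> \<le> 2 * \<bar>u * v\<bar>"
        unfolding abs_mult[of y] using y by (intro mult_right_mono) auto
      moreover have "\<bar>e * u\<^sup>2\<bar> \<le> 1 * u\<^sup>2"
        unfolding abs_mult[of e] using e by (intro mult_mono) auto
      moreover have "\<bar>A - 2 * u\<^sup>2 + B\<bar> \<le> \<bar>A\<bar> + 2 * u\<^sup>2 + \<bar>B\<bar>" for A B
        using zero_le_power2[of u] by linarith
      note this[of "y * (u * v)" "e * u\<^sup>2"]
      ultimately show ?thesis using two[of u v] zero_le_power2[of v] by argo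
    qed
    also have "4 * (u\<^sup>2 + v\<^sup>2) \<le> 4 / d * E n"
      using E_ge[of n] d by (simp add: u_def v_def field_simps)
    finally have "E (Suc n) \<le> E n + \<bar>e\<bar> * (4 / d * E n)" by (simp add: mult_left_mono)
    then show ?thesis by (simp add: e_def abs_mult power_abs algebra_simps)
  qed
  have E_nonneg: "0 \<le> E n" for n
    using d by (intro order.trans[OF _ E_ge[of n]]) simp
  \<comment> \<open>Discrete Gronwall argument: \<open>1 + t \<le> exp t\<close> turns the product
    of the growth factors into the exponential of a geometric sum, which stays bounded.\<close>
  have E_exp: "E n \<le> E 0 * exp (\<Sum>i<n. 4 / d * \<bar>q\<bar> ^ Suc i)" for n
  proof (induction n)
    case (Suc n)
    have "E (Suc n) \<le> exp (4 / d * \<bar>q\<bar> ^ Suc n) * E n"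
      using E_step[of n] by (rule order.trans) (intro mult_right_mono exp_ge_add_one_self E_nonneg)
    also have "\<dots> \<le> exp (4 / d * \<bar>q\<bar> ^ Suc n) * (E 0 * exp (\<Sum>i<n. 4 / d * \<bar>q\<bar> ^ Suc i))"
      by (intro mult_left_mono Suc) simp
    finally show ?case by (simp add: exp_add mult_ac)
  qed simp
  define S where "S = (\<Sum>i. 4 / d * \<bar>q\<bar> ^ Suc i)"
  have "summable (\<lambda>i. 4 / d * \<bar>q\<bar> ^ Suc i)"
    using q by (intro summable_mult) (simp add: summable_geometric)
  then have "(\<Sum>i<n. 4 / d * \<bar>q\<bar> ^ Suc i) \<le> S" for n
    unfolding S_def using d by (intro sum_le_suminf) auto
  then have E_bound: "E n \<le> E 0 * exp S" for n
    by (intro order.trans[OF E_exp] mult_left_mono E_nonneg) simp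
  show thesis
  proof
    fix n
    have "d * (h n)\<^sup>2 \<le> d * ((h n)\<^sup>2 + (h (Suc n))\<^sup>2)" using d by simp
    also have "\<dots> \<le> E 0 * exp S" using E_ge E_bound by (rule order.trans)
    finally have "(h n)\<^sup>2 \<le> E 0 * exp S / d" using d by (simp add: field_simps)
    then show "\<bar>h n\<bar> \<le> sqrt (E 0 * exp S / d)" by (metis real_sqrt_abs real_sqrt_le_mono)
  qed
qed

section \<open>Rescaled q-Hermite polynomials\<close>

text \<open>For \<open>sqrt (1 - q) * x\<close> = 2 cos t these are Rogers' continuous q-Hermite
  polynomials at cos t: the coefficient \<open>qnum q n\<close> of the recurrence becomes
  \<open>1 - q ^ n\<close>.\<close>

definition qHermite_resc :: "real \<Rightarrow> real \<Rightarrow> nat \<Rightarrow> real" where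
  "qHermite_resc x q n = sqrt (1 - q) ^ n * qHermite n x q"

lemma qHermite_resc_rec:
  assumes "\<bar>q\<bar> < 1"
  shows "qHermite_resc x q (Suc (Suc n)) =
    sqrt (1 - q) * x * qHermite_resc x q (Suc n) - (1 - q ^ Suc n) * qHermite_resc x q n"
proof -
  have "(1 - q) * qnum q (Suc n) = 1 - q ^ Suc n"
    unfolding qnum_def by (rule one_diff_power_eq[symmetric])
  moreover have "sqrt (1 - q) * sqrt (1 - q) = 1 - q" using assms by simp
  ultimately have e: "1 - q ^ Suc n = sqrt (1 - q) * sqrt (1 - q) * qnum q (Suc n)" by simp
  show ?thesis
    unfolding e qHermite_resc_def qHermite.simps power_Suc[of "sqrt _"] by (simp only: algebra_simps)
qed

text \<open>Combines three consecutive instances of the recurrence. The last one is solved for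
  \<open>?y\<close> times the odd-index value, so that only even indices and the square of
  \<open>?y\<close> remain.\<close>

lemma qHermite_resc_even_rec:
  assumes "\<bar>q\<bar> < 1"
  shows "qHermite_resc x q (2 * Suc (Suc n)) =
    ((1 - q) * x\<^sup>2 - 2 + q ^ (2 * Suc n) + q ^ Suc (2 * Suc n)) * qHermite_resc x q (2 * Suc n)
    - (1 - q ^ (2 * Suc n)) * (1 - q ^ Suc (2 * n)) * qHermite_resc x q (2 * n)"
proof -
  let ?h = "qHermite_resc x q" and ?y = "sqrt (1 - q) * x"
  have y2: "?y * ?y = (1 - q) * x\<^sup>2" using assms by (simp add: power2_eq_square algebra_simps)
  note r = qHermite_resc_rec[OF assms, of x]
  have e: "?h (2 * Suc (Suc n)) = ?y * ?h (Suc (2 * Suc n)) - (1 - q ^ Suc (2 * Suc n)) * ?h (2 * Suc n)"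
    using r[of "2 * Suc n"] by simp
  have o: "?h (Suc (2 * Suc n)) = ?y * ?h (2 * Suc n) - (1 - q ^ (2 * Suc n)) * ?h (Suc (2 * n))"
    using r[of "Suc (2 * n)"] by simp
  have e': "?y * ?h (Suc (2 * n)) = ?h (2 * Suc n) + (1 - q ^ Suc (2 * n)) * ?h (2 * n)"
    using r[of "2 * n"] by simp
  have "?h (2 * Suc (Suc n)) = ?y * ?y * ?h (2 * Suc n)
      - (1 - q ^ (2 * Suc n)) * (?y * ?h (Suc (2 * n))) - (1 - q ^ Suc (2 * Suc n)) * ?h (2 * Suc n)"
    unfolding e o by (simp only: algebra_simps)
  then show ?thesis unfolding y2 e' by (simp only: algebra_simps)
qed

section \<open>The series: uniform bounds, summability, limit at small argument\<close>

definition kernel_term :: "real \<Rightarrow> real \<Rightarrow> real \<Rightarrow> nat \<Rightarrow> real" where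
  "kernel_term x q b k = b ^ k * qHermite_resc x q (2 * k) / (qpoch q q k * qpoch (b * q) q k)"

lemma kernel_term_eq:
  assumes "\<bar>q\<bar> < 1"
  shows "b ^ k / (qfact q k * qpoch (b * q) q k) * qHermite (2 * k) x q = kernel_term x q b k"
proof -
  have "qpoch q q k = (1 - q) ^ k * qfact q k"
  proof (induction k)
    case (Suc k)
    have "(1 - q) * qnum q (Suc k) = 1 - q ^ Suc k"
      unfolding qnum_def by (rule one_diff_power_eq[symmetric])
    with Suc show ?case by (simp add: qpoch_Suc qfact_def mult_ac)
  qed (simp add: qpoch_def qfact_def)
  moreover have "sqrt (1 - q) ^ (2 * k) = (1 - q) ^ k"
    using assms by (simp add: power_mult)
  moreover have "q \<noteq> 1" using assms by auto
  ultimately show ?thesis by (simp add: kernel_term_def qHermite_resc_def)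
qed

text \<open>\<open>C\<close> does not depend on \<open>b\<close>, which permits the later passage
  along \<open>b * q ^ n\<close>. The second bound, with the numerator one index ahead, controls the
  remainder of the telescoped partial sums.\<close>

lemma kernel_term_bound:
  assumes q: "\<bar>q\<bar> < 1" and y: "\<bar>sqrt (1 - q) * x\<bar> < 2"
  obtains C where "\<And>b k. \<bar>b\<bar> < 1 \<Longrightarrow> \<bar>kernel_term x q b k\<bar> \<le> C * \<bar>b\<bar> ^ k"
    "\<And>b k. \<bar>b\<bar> < 1 \<Longrightarrow> \<bar>qHermite_resc x q (2 * Suc k) / (qpoch q q k * qpoch (b * q) q k)\<bar> \<le> C"
proof -
  obtain M where M: "\<And>n. \<bar>qHermite_resc x q n\<bar> \<le> M"
    using perturbed_Chebyshev_recurrence_bounded[OF qHermite_resc_rec[OF q] y q] by metis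
  obtain c where c: "c > 0" "\<And>a k. \<bar>a\<bar> \<le> \<bar>q\<bar> \<Longrightarrow> c \<le> \<bar>qpoch a q k\<bar>"
    using qpoch_uniform_lower_bound[OF q] by metis
  have *: "\<bar>qHermite_resc x q n / (qpoch q q k * qpoch (b * q) q k)\<bar> \<le> M / (c * c)"
    if "\<bar>b\<bar> < 1" for b n k
  proof -
    have "\<bar>b * q\<bar> \<le> \<bar>q\<bar>" using that by (simp add: abs_mult mult_left_le_one_le)
    then have "c * c \<le> \<bar>qpoch q q k\<bar> * \<bar>qpoch (b * q) q k\<bar>"
      using c by (intro mult_mono) auto
    then show ?thesis
      unfolding abs_divide abs_mult using M[of n] c(1) by (intro frac_le) auto
  qed
  show thesis
  proof
    fix b :: real and k assume "\<bar>b\<bar> < 1"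
    then have "\<bar>b ^ k\<bar> * \<bar>qHermite_resc x q (2 * k) / (qpoch q q k * qpoch (b * q) q k)\<bar>
        \<le> \<bar>b ^ k\<bar> * (M / (c * c))" by (intro mult_left_mono *) auto
    then show "\<bar>kernel_term x q b k\<bar> \<le> M / (c * c) * \<bar>b\<bar> ^ k"
      by (simp add: kernel_term_def abs_mult power_abs mult_ac)
  qed (rule *)
qed

lemma summable_kernel_term:
  assumes "\<bar>q\<bar> < 1" "\<bar>sqrt (1 - q) * x\<bar> < 2" "\<bar>b\<bar> < 1"
  shows "summable (kernel_term x q b)"
proof -
  obtain C where C: "\<And>k. \<bar>kernel_term x q b k\<bar> \<le> C * \<bar>b\<bar> ^ k"
    by (rule kernel_term_bound[OF assms(1,2)]) (rule that, use assms(3) in blast)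
  have "summable (\<lambda>k. C * \<bar>b\<bar> ^ k)"
    using assms(3) by (intro summable_mult summable_geometric) simp
  then show ?thesis by (rule summable_comparison_test'[where N = 0]) (simp add: C)
qed

text \<open>The term of index 0 is always 1, and every later term contains at least one factor
  \<open>b * q ^ n\<close>. Extracting |q| ^ n from the tail leaves a convergent geometric
  series.\<close>

lemma kernel_sum_tendsto_1:
  assumes q: "\<bar>q\<bar> < 1" and y: "\<bar>sqrt (1 - q) * x\<bar> < 2" and b: "\<bar>b\<bar> < 1"
  shows "(\<lambda>n. suminf (kernel_term x q (b * q ^ n))) \<longlonglongrightarrow> 1"
proof -
  obtain C where C: "\<And>b k. \<bar>b\<bar> < 1 \<Longrightarrow> \<bar>kernel_term x q b k\<bar> \<le> C * \<bar>b\<bar> ^ k"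
    by (rule kernel_term_bound[OF q y]) (rule that)
  \<comment> \<open>At \<open>b = 0\<close> and \<open>k = 0\<close> the right-hand side of the
    bound is \<open>C\<close>, since \<open>0 ^ 0 = 1\<close>.\<close>
  have C0: "0 \<le> C" using C[of 0 0] by simp
  have geom: "summable (\<lambda>k. \<bar>b\<bar> ^ k)" using b by (intro summable_geometric) simp
  have bound: "\<bar>suminf (kernel_term x q (b * q ^ n)) - 1\<bar> \<le> \<bar>q\<bar> ^ n * (C * (\<Sum>k. \<bar>b\<bar> ^ k))" for n
  proof -
    let ?g = "kernel_term x q (b * q ^ n)"
    have lt: "\<bar>b * q ^ n\<bar> < 1" by (rule abs_mult_power_less_1[OF b q])
    have s: "summable ?g" by (rule summable_kernel_term[OF q y lt])
    have bd: "\<bar>?g (Suc k)\<bar> \<le> \<bar>q\<bar> ^ n * C * \<bar>b\<bar> ^ k" for k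
    proof -
      \<comment> \<open>One factor |q| ^ n and \<open>k\<close> factors |b| are kept; everything
        else is at most 1.\<close>
      have "\<bar>b * q ^ n\<bar> ^ Suc k = (\<bar>q\<bar> ^ n * \<bar>b\<bar> ^ k) * (\<bar>b\<bar> * (\<bar>q\<bar> ^ n) ^ k)"
        by (simp add: abs_mult power_abs power_mult_distrib)
      also have "\<dots> \<le> (\<bar>q\<bar> ^ n * \<bar>b\<bar> ^ k) * 1"
        using b q by (intro mult_left_mono mult_le_one power_le_one) (auto intro: power_le_one)
      finally have "C * \<bar>b * q ^ n\<bar> ^ Suc k \<le> C * (\<bar>q\<bar> ^ n * \<bar>b\<bar> ^ k)"
        using C0 by (intro mult_left_mono) simp
      then show ?thesis using C[OF lt, of "Suc k"] by (simp add: mult_ac)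
    qed
    have "suminf ?g - 1 = (\<Sum>k. ?g (Suc k))"
      using suminf_split_head[OF s] by (simp add: kernel_term_def qHermite_resc_def qpoch_def)
    also have "norm \<dots> \<le> (\<Sum>k. \<bar>q\<bar> ^ n * C * \<bar>b\<bar> ^ k)"
      using bd by (intro norm_suminf_le summable_mult geom) auto
    finally show ?thesis by 
      (simp only: real_norm_def suminf_mult[OF geom] suminf_mult[OF summable_mult[OF geom]] mult.assoc)
  qed
  have "(\<lambda>n. \<bar>q\<bar> ^ n * (C * (\<Sum>k. \<bar>b\<bar> ^ k))) \<longlonglongrightarrow> 0"
    using q by (intro tendsto_mult_left_zero LIMSEQ_power_zero) simp
  then have "(\<lambda>n. suminf (kernel_term x q (b * q ^ n)) - 1) \<longlonglongrightarrow> 0"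
    by (rule Lim_null_comparison[rotated]) (simp add: bound)
  then show ?thesis by (simp add: LIM_zero_iff)
qed

section \<open>The functional equation between the arguments \<open>b\<close> and
  \<open>b * q\<close>\<close>

text \<open>
  The last two lines of the right-hand side are the telescoping remainder, which vanishes as \<open>n\<close>
  grows; the sum in its first line tends to a multiple of the series at \<open>b * q\<close>.
\<close>

lemma kernel_partial_sum:
  assumes q: "\<bar>q\<bar> < 1" and b: "\<bar>b\<bar> < 1"
  shows "((1 + b)\<^sup>2 - (1 - q) * x\<^sup>2 * b) * (\<Sum>k\<le>n. kernel_term x q b k) =
    (1 + b) * (1 - b\<^sup>2 * q) * (\<Sum>k\<le>n. q ^ k * kernel_term x q b k / (1 - b * q ^ Suc k))
    + (b\<^sup>2 * (1 + q ^ Suc n) * (1 - q ^ Suc (2 * n)) / (1 - b * q ^ Suc n) * kernel_term x q b n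
      - b ^ Suc n * (qHermite_resc x q (2 * Suc n) / (qpoch q q n * qpoch (b * q) q n)))"
proof (induction n)
  case 0
  have "sqrt (1 - q) * x * (sqrt (1 - q) * x) = (1 - q) * x\<^sup>2"
    using q by (simp add: power2_eq_square algebra_simps)
  moreover have "qHermite_resc x q 0 = 1" "qHermite_resc x q 1 = sqrt (1 - q) * x"
    by (simp_all add: qHermite_resc_def)
  ultimately have h2: "qHermite_resc x q 2 = (1 - q) * x\<^sup>2 - (1 - q)"
    using qHermite_resc_rec[OF q, of x 0] by (simp add: numeral_2_eq_2 mult.assoc)
  have nz: "1 - b * q \<noteq> 0" using one_minus_mult_power_neq_0[OF b q, of 1] by simp
  \<comment> \<open>The case \<open>Q = 1\<close> of the polynomial identity used in the induction
    step.\<close>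
  have "(1 + b) * (1 - b\<^sup>2 * q) + b\<^sup>2 * (1 + q) * (1 - q) =
      ((1 + b)\<^sup>2 - b * (1 - q)) * (1 - b * q)"
    by (simp add: power2_eq_square algebra_simps)
  then have key: "(1 + b) * (1 - b\<^sup>2 * q) / (1 - b * q) + b\<^sup>2 * (1 + q) * (1 - q) / (1 - b * q) =
      (1 + b)\<^sup>2 - b * (1 - q)"
    using nz by (simp add: add_divide_distrib[symmetric])
  have t0: "kernel_term x q b 0 = 1" by (simp add: kernel_term_def qpoch_def qHermite_resc_def)
  have "(1 + b)\<^sup>2 - (1 - q) * x\<^sup>2 * b =
      (1 + b)\<^sup>2 - b * (1 - q) - b * ((1 - q) * x\<^sup>2 - (1 - q))"
    by (simp add: algebra_simps)
  then show ?case
    unfolding key[symmetric] h2[symmetric] by (simp add: t0 qpoch_def)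
next
  case (Suc n)
  let ?t = "kernel_term x q b" and ?h = "\<lambda>n. qHermite_resc x q (2 * n)"
  \<comment> \<open>\<open>w\<close> is common to the new term and to both remainders. Once it is
    extracted, the step is a linear identity in three consecutive even-index values.\<close>
  define Q p r w where "Q = q ^ Suc n" and "p = qpoch q q n" and "r = qpoch (b * q) q n"
    and "w = b ^ Suc n / (qpoch q q (Suc n) * qpoch (b * q) q (Suc n))"
  define S T where "S = (\<Sum>k\<le>n. ?t k)"
    and "T = (\<Sum>k\<le>n. q ^ k * ?t k / (1 - b * q ^ Suc k))"
  \<comment> \<open>\<open>s\<close> occurs both in the old remainder and in the even-index
    recurrence, where the two occurrences match, so it is never expanded.\<close>
  define s where "s = 1 - q ^ Suc (2 * n)"
  let ?D = "(1 + b)\<^sup>2 - (1 - q) * x\<^sup>2 * b" and ?c = "(1 + b) * (1 - b\<^sup>2 * q)"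
  have bq: "\<bar>b * q\<bar> < 1" using abs_mult_power_less_1[OF b q, of 1] by simp
  have nz: "p \<noteq> 0" "r \<noteq> 0" "1 - Q \<noteq> 0" "1 - b * Q \<noteq> 0" "1 - b * (q * Q) \<noteq> 0"
    using qpoch_neq_0[OF q q] qpoch_neq_0[OF bq q]
      one_minus_mult_power_neq_0[OF q q, of n] one_minus_mult_power_neq_0[OF b q, of "Suc n"]
      one_minus_mult_power_neq_0[OF b q, of "Suc (Suc n)"]
    by (auto simp: p_def r_def Q_def)
  have w: "b * b ^ n / (p * r) = w * ((1 - Q) * (1 - b * Q))"
    using nz by (simp add: w_def qpoch_Suc p_def[symmetric] r_def[symmetric] Q_def[symmetric] mult.assoc
      power_Suc[symmetric] del: power_Suc)
  have t1: "?t (Suc n) = w * ?h (Suc n)"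
    by (simp add: kernel_term_def w_def)
  have t0: "b * ?t n = w * ((1 - Q) * (1 - b * Q)) * ?h n"
    unfolding w[symmetric] by (simp add: kernel_term_def p_def r_def)
  have "q ^ (2 * Suc n) = Q\<^sup>2"
    unfolding Q_def by (simp only: power_mult[symmetric] mult.commute)
  then have Q2: "q ^ (2 * Suc n) = Q\<^sup>2" "q ^ Suc (2 * Suc n) = q * Q\<^sup>2" "q ^ Suc (Suc n) = q * Q"
    by (simp_all only: power_Suc Q_def)
  have h2: "?h (Suc (Suc n)) = ((1 - q) * x\<^sup>2 - 2 + Q\<^sup>2 + q * Q\<^sup>2) * ?h (Suc n) - (1 - Q\<^sup>2) * s * ?h n"
    unfolding qHermite_resc_even_rec[OF q] Q2 s_def ..
  have "b\<^sup>2 * (1 + Q) * s / (1 - b * Q) * ?t n = b * (1 + Q) * s / (1 - b * Q) * (b * ?t n)"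
    by (simp add: power2_eq_square)
  also have "\<dots> = b * (1 + Q) * s * w * (1 - Q) * ?h n"
    unfolding t0 using nz by simp
  finally have V0_h: "b\<^sup>2 * (1 + Q) * s / (1 - b * Q) * ?t n = b * (1 + Q) * s * w * (1 - Q) * ?h n" .
  have "b ^ Suc n * (?h (Suc n) / (p * r)) = b * b ^ n / (p * r) * ?h (Suc n)" by simp
  then have V0: "b\<^sup>2 * (1 + Q) * s / (1 - b * Q) * ?t n - b ^ Suc n * (?h (Suc n) / (p * r)) =
      w * (b * (1 - Q\<^sup>2) * s * ?h n - (1 - Q) * (1 - b * Q) * ?h (Suc n))"
    unfolding V0_h w by (simp add: power2_eq_square algebra_simps)
  have V1: "b ^ Suc (Suc n) * (?h (Suc (Suc n)) / (qpoch q q (Suc n) * qpoch (b * q) q (Suc n))) =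
      w * (b * ?h (Suc (Suc n)))"
    by (simp add: w_def)
  \<comment> \<open>Splits the coefficient of \<open>?t (Suc n)\<close> into the new summand of
    \<open>T\<close> and the new remainder.\<close>
  have "?c * Q + b\<^sup>2 * (1 + q * Q) * (1 - q * Q\<^sup>2) =
      ((1 + b)\<^sup>2 + b * (Q\<^sup>2 + q * Q\<^sup>2 - 2) - (1 - Q) * (1 - b * Q)) * (1 - b * (q * Q))"
    by (simp add: power2_eq_square algebra_simps)
  then have key: "?c * Q / (1 - b * (q * Q)) + b\<^sup>2 * (1 + q * Q) * (1 - q * Q\<^sup>2) / (1 - b * (q * Q)) =
      (1 + b)\<^sup>2 + b * (Q\<^sup>2 + q * Q\<^sup>2 - 2) - (1 - Q) * (1 - b * Q)"
    using nz(5) by (simp add: add_divide_distrib[symmetric])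
  have IH: "?D * S = ?c * T + w * (b * (1 - Q\<^sup>2) * s * ?h n - (1 - Q) * (1 - b * Q) * ?h (Suc n))"
    using Suc.IH unfolding S_def[symmetric] T_def[symmetric] Q_def[symmetric] s_def[symmetric]
      p_def[symmetric] r_def[symmetric] V0 .
  \<comment> \<open>By \<open>h2\<close>, the \<open>?h n\<close> part of the old remainder is
    absorbed into \<open>?h (Suc (Suc n))\<close>, and the terms in \<open>x\<^sup>2\<close> cancel
    against those of \<open>?D\<close>.\<close>
  have "?D * (S + ?t (Suc n)) = ?c * T +
      (((1 + b)\<^sup>2 + b * (Q\<^sup>2 + q * Q\<^sup>2 - 2) - (1 - Q) * (1 - b * Q)) * ?t (Suc n)
        - w * (b * ?h (Suc (Suc n))))"
    unfolding distrib_left IH t1 h2 by (simp add: algebra_simps)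
  also have "\<dots> = ?c * (T + Q * ?t (Suc n) / (1 - b * (q * Q))) +
      (b\<^sup>2 * (1 + q * Q) * (1 - q * Q\<^sup>2) / (1 - b * (q * Q)) * ?t (Suc n) - w * (b * ?h (Suc (Suc n))))"
    unfolding key[symmetric] by (simp add: distrib_left distrib_right)
  finally show ?case
    unfolding sum.atMost_Suc S_def[symmetric] T_def[symmetric] V1 Q2 Q_def[symmetric] .
qed

text \<open>The limit of \<open>kernel_partial_sum\<close>: the remainder \<open>?V\<close> vanishes
  because the terms of a summable series tend to 0 and \<open>?e\<close> is bounded.\<close>

lemma kernel_sum_functional_equation:
  assumes q: "\<bar>q\<bar> < 1" and y: "\<bar>sqrt (1 - q) * x\<bar> < 2" and b: "\<bar>b\<bar> < 1"
  shows "((1 + b)\<^sup>2 - (1 - q) * x\<^sup>2 * b) * suminf (kernel_term x q b) =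
    (1 + b) * (1 - b\<^sup>2 * q) / (1 - b * q) * suminf (kernel_term x q (b * q))"
proof -
  let ?t = "kernel_term x q b"
  let ?e = "\<lambda>n. qHermite_resc x q (2 * Suc n) / (qpoch q q n * qpoch (b * q) q n)"
  let ?V = "\<lambda>n. b\<^sup>2 * (1 + q ^ Suc n) * (1 - q ^ Suc (2 * n)) / (1 - b * q ^ Suc n) * ?t n
    - b ^ Suc n * ?e n"
  have bq: "\<bar>b * q\<bar> < 1" using abs_mult_power_less_1[OF b q, of 1] by simp
  obtain C where C: "\<And>b k. \<bar>b\<bar> < 1 \<Longrightarrow>
      \<bar>qHermite_resc x q (2 * Suc k) / (qpoch q q k * qpoch (b * q) q k)\<bar> \<le> C"
    by (rule kernel_term_bound[OF q y]) (rule that)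
  have s: "summable ?t" by (rule summable_kernel_term[OF q y b])
  \<comment> \<open>The power \<open>q ^ k\<close> changes \<open>b ^ k\<close> into
    \<open>(b * q) ^ k\<close>, and the extra denominator shifts \<open>qpoch (b * q) q k\<close> to
    \<open>qpoch (b * q * q) q k\<close> at the cost of \<open>1 - b * q\<close>.\<close>
  have t: "q ^ k * ?t k / (1 - b * q ^ Suc k) = kernel_term x q (b * q) k / (1 - b * q)" for k
  proof -
    have "qpoch (b * q) q k * (1 - b * q ^ Suc k) = (1 - b * q) * qpoch (b * q * q) q k"
      using qpoch_Suc[of "b * q" q k] qpoch_Suc_shift[of "b * q" q k] by (simp add: mult.assoc)
    then show ?thesis
      by (simp add: kernel_term_def power_mult_distrib mult_ac)
  qed
  have sub: "(\<lambda>n. q ^ Suc (2 * n)) \<longlonglongrightarrow> 0"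
  proof -
    have "(\<lambda>n. q * (q\<^sup>2) ^ n) \<longlonglongrightarrow> 0"
      using q by (intro tendsto_mult_right_zero LIMSEQ_power_zero) (simp add: abs_square_less_1)
    then show ?thesis by (simp add: power_mult)
  qed
  have pow: "(\<lambda>n. a ^ Suc n) \<longlonglongrightarrow> 0" if "\<bar>a\<bar> < 1" for a :: real
    using LIMSEQ_Suc[OF LIMSEQ_power_zero[of a]] that by simp
  \<comment> \<open>The limit is left unevaluated so that it has the shape produced by the limit
    rules.\<close>
  have V1: "(\<lambda>n. b\<^sup>2 * (1 + q ^ Suc n) * (1 - q ^ Suc (2 * n)) / (1 - b * q ^ Suc n) * ?t n)
      \<longlonglongrightarrow> b\<^sup>2 * (1 + 0) * (1 - 0) / (1 - b * 0) * 0"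
    by (intro tendsto_mult tendsto_divide tendsto_add tendsto_diff tendsto_const pow q sub
        summable_LIMSEQ_zero[OF s]) simp
  have V2: "(\<lambda>n. b ^ Suc n * ?e n) \<longlonglongrightarrow> 0"
  proof (rule Lim_null_comparison)
    show "eventually (\<lambda>n. norm (b ^ Suc n * ?e n) \<le> \<bar>b\<bar> ^ Suc n * C) sequentially"
      unfolding real_norm_def abs_mult[of "b ^ _"] power_abs
      by (intro always_eventually allI mult_left_mono C b) simp
    show "(\<lambda>n. \<bar>b\<bar> ^ Suc n * C) \<longlonglongrightarrow> 0"
      using b by (intro tendsto_mult_left_zero pow) simp
  qed
  have V: "?V \<longlonglongrightarrow> 0" using tendsto_diff[OF V1 V2] by simp
  have rhs: "(\<lambda>n. (1 + b) * (1 - b\<^sup>2 * q) * ((\<Sum>k\<le>n. kernel_term x q (b * q) k) / (1 - b * q)) + ?V n)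
      \<longlonglongrightarrow> (1 + b) * (1 - b\<^sup>2 * q) * (suminf (kernel_term x q (b * q)) / (1 - b * q)) + 0"
    using bq by (intro tendsto_add V tendsto_mult tendsto_divide tendsto_const
        summable_LIMSEQ' summable_kernel_term q y) auto
  have "(\<lambda>n. ((1 + b)\<^sup>2 - (1 - q) * x\<^sup>2 * b) * (\<Sum>k\<le>n. ?t k))
      \<longlonglongrightarrow> ((1 + b)\<^sup>2 - (1 - q) * x\<^sup>2 * b) * suminf ?t"
    by (intro tendsto_mult tendsto_const summable_LIMSEQ' s)
  then have "(\<lambda>n. (1 + b) * (1 - b\<^sup>2 * q) * ((\<Sum>k\<le>n. kernel_term x q (b * q) k) / (1 - b * q)) + ?V n)
      \<longlonglongrightarrow> ((1 + b)\<^sup>2 - (1 - q) * x\<^sup>2 * b) * suminf ?t"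
    unfolding kernel_partial_sum[OF q b] t sum_divide_distrib .
  from LIMSEQ_unique[OF this rhs] show ?thesis by simp
qed

section \<open>Iteration to the product formula, and the densities\<close>

text \<open>Makes the denominators of \<open>f_R\<close> nonzero. For positive \<open>b\<close> it
  follows from \<open>(1 - q) * x\<^sup>2 < 4\<close> and
  \<open>4 * b \<le> (1 + b)\<^sup>2\<close>; otherwise the subtracted term is not positive.\<close>

lemma kernel_factor_pos:
  fixes b x q :: real
  assumes q: "\<bar>q\<bar> < 1" and y: "\<bar>sqrt (1 - q) * x\<bar> < 2" and b: "-1 < b" "b \<le> 1"
  shows "(1 + b)\<^sup>2 - (1 - q) * x\<^sup>2 * b > 0"
proof -
  have "(sqrt (1 - q) * x)\<^sup>2 < 2\<^sup>2" using power_strict_mono[OF y, of 2] by simp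
  then have lt: "(1 - q) * x\<^sup>2 < 4" using q by (simp add: power_mult_distrib)
  have nonneg: "0 \<le> (1 - q) * x\<^sup>2" using q by simp
  show ?thesis
  proof (cases "b > 0")
    case True
    have "(1 - q) * x\<^sup>2 * b < 4 * b" using lt True by (intro mult_strict_right_mono)
    moreover have "4 * b \<le> (1 + b)\<^sup>2"
      using zero_le_power2[of "1 - b"] by (simp add: power2_eq_square algebra_simps)
    ultimately show ?thesis by linarith
  next
    case False
    then have "(1 - q) * x\<^sup>2 * b \<le> 0" using nonneg by (intro mult_nonneg_nonpos) auto
    moreover have "0 < (1 + b)\<^sup>2" using b by simp
    ultimately show ?thesis by linarith
  qed
qed

text \<open>With \<open>c = b * q ^ n\<close>, multiplying the functional equation at
  \<open>c\<close> by \<open>(1 - c) * (1 - c * q)\<close> clears its denominator and turns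
  \<open>1 + c\<close> into \<open>1 - c\<^sup>2\<close>. Each step thus supplies two consecutive
  factors, \<open>1 - c\<^sup>2\<close> and \<open>1 - c\<^sup>2 * q\<close>, whence the length
  \<open>2 * n\<close>.\<close>

lemma kernel_sum_iterate:
  assumes q: "\<bar>q\<bar> < 1" and y: "\<bar>sqrt (1 - q) * x\<bar> < 2" and b: "\<bar>b\<bar> < 1"
  shows "qpoch b q n * qpoch (b * q) q n *
      (\<Prod>k<n. (1 + b * q ^ k)\<^sup>2 - (1 - q) * b * x\<^sup>2 * q ^ k) * suminf (kernel_term x q b) =
    qpoch (b\<^sup>2) q (2 * n) * suminf (kernel_term x q (b * q ^ n))"
proof (induction n)
  case (Suc n)
  define c where "c = b * q ^ n"
  have c: "\<bar>c\<bar> < 1" unfolding c_def by (rule abs_mult_power_less_1[OF b q])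
  have nz: "1 - c * q \<noteq> 0" using one_minus_mult_power_neq_0[OF c q, of 1] by simp
  let ?D = "(1 + c)\<^sup>2 - (1 - q) * x\<^sup>2 * c" and ?G = "\<lambda>b. suminf (kernel_term x q b)"
  have sq: "1 - c\<^sup>2 = (1 - c) * (1 + c)" by (simp add: power2_eq_square algebra_simps)
  have "(1 - c) * (1 - c * q) * (?D * ?G c) = (1 - c\<^sup>2) * (1 - c\<^sup>2 * q) * ?G (c * q)"
    unfolding kernel_sum_functional_equation[OF q y c] sq using nz by simp
  then have "qpoch (b\<^sup>2) q (2 * n) * ((1 - c) * (1 - c * q) * (?D * ?G c)) =
      qpoch (b\<^sup>2) q (2 * n) * ((1 - c\<^sup>2) * (1 - c\<^sup>2 * q) * ?G (c * q))"
    by simp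
  then have "(1 - c) * (1 - c * q) * ?D * (qpoch (b\<^sup>2) q (2 * n) * ?G c) =
      qpoch (b\<^sup>2) q (2 * n) * (1 - c\<^sup>2) * (1 - c\<^sup>2 * q) * ?G (c * q)"
    by (simp only: mult_ac)
  then have step: "(1 - c) * (1 - c * q) * ?D * (qpoch b q n * qpoch (b * q) q n *
      (\<Prod>k<n. (1 + b * q ^ k)\<^sup>2 - (1 - q) * b * x\<^sup>2 * q ^ k) * ?G b) =
      qpoch (b\<^sup>2) q (2 * n) * (1 - c\<^sup>2) * (1 - c\<^sup>2 * q) * ?G (c * q)"
    unfolding Suc.IH c_def .
  have "b\<^sup>2 * q ^ (2 * n) = c\<^sup>2"
    unfolding c_def by (simp only: power_mult_distrib power_mult[symmetric] mult.commute)
  moreover from this have "b\<^sup>2 * q ^ Suc (2 * n) = c\<^sup>2 * q" by (simp add: mult_ac)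
  ultimately have num: "qpoch (b\<^sup>2) q (2 * Suc n) = qpoch (b\<^sup>2) q (2 * n) * (1 - c\<^sup>2) * (1 - c\<^sup>2 * q)"
    by (simp add: qpoch_Suc del: power_Suc)
  have den: "qpoch b q (Suc n) = qpoch b q n * (1 - c)"
    "qpoch (b * q) q (Suc n) = qpoch (b * q) q n * (1 - c * q)"
    and arg: "b * q ^ Suc n = c * q"
    by (simp_all add: qpoch_Suc c_def mult_ac)
  have D: "(1 + b * q ^ n)\<^sup>2 - (1 - q) * b * x\<^sup>2 * q ^ n = ?D"
    by (simp add: c_def mult_ac)
  show ?case
    unfolding num den arg prod.lessThan_Suc D step[symmetric] by (simp only: mult_ac)
qed (simp add: qpoch_def)

text \<open>Both sides are limits of the same sequence, evaluated directly and through
  \<open>kernel_sum_iterate\<close>.\<close>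

lemma kernel_sum_product_formula:
  assumes q: "\<bar>q\<bar> < 1" and y: "\<bar>sqrt (1 - q) * x\<bar> < 2" and b: "\<bar>b\<bar> < 1"
    and conv: "convergent_prod (\<lambda>k. (1 + b * q ^ k)\<^sup>2 - (1 - q) * b * x\<^sup>2 * q ^ k)"
  shows "qpoch_inf b q * qpoch_inf (b * q) q *
      (\<Prod>k. (1 + b * q ^ k)\<^sup>2 - (1 - q) * b * x\<^sup>2 * q ^ k) * suminf (kernel_term x q b) =
    qpoch_inf (b\<^sup>2) q"
proof (rule LIMSEQ_unique)
  show "(\<lambda>n. qpoch b q n * qpoch (b * q) q n *
      (\<Prod>k<n. (1 + b * q ^ k)\<^sup>2 - (1 - q) * b * x\<^sup>2 * q ^ k) * suminf (kernel_term x q b))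
    \<longlonglongrightarrow> qpoch_inf b q * qpoch_inf (b * q) q *
      (\<Prod>k. (1 + b * q ^ k)\<^sup>2 - (1 - q) * b * x\<^sup>2 * q ^ k) * suminf (kernel_term x q b)"
    by (intro tendsto_mult tendsto_const qpoch_tendsto[OF q]
        has_prod_imp_tendsto'[OF convergent_prod_has_prod[OF conv]])
  have "filterlim (\<lambda>n. 2 * n :: nat) sequentially sequentially"
    by (rule filterlim_subseq) (simp add: strict_mono_def)
  then have "(\<lambda>n. qpoch (b\<^sup>2) q (2 * n)) \<longlonglongrightarrow> qpoch_inf (b\<^sup>2) q"
    by (rule filterlim_compose[OF qpoch_tendsto[OF q]])
  from tendsto_mult[OF this kernel_sum_tendsto_1[OF q y b]]
  show "(\<lambda>n. qpoch b q n * qpoch (b * q) q n *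
      (\<Prod>k<n. (1 + b * q ^ k)\<^sup>2 - (1 - q) * b * x\<^sup>2 * q ^ k) * suminf (kernel_term x q b))
    \<longlonglongrightarrow> qpoch_inf (b\<^sup>2) q"
    unfolding kernel_sum_iterate[OF q y b] by simp
qed

text \<open>Summability is asserted separately, since an equation about \<open>suminf\<close> does
  not by itself express convergence.\<close>

theorem mainTheorem4:
  fixes q \<beta> x :: real
  assumes "\<bar>q\<bar> < 1" and "\<bar>\<beta>\<bar> < 1" and "\<bar>x\<bar> < 2 / sqrt (1 - q)"
  shows "summable (\<lambda>k. \<beta> ^ k / (qfact q k * qpoch (\<beta> * q) q k) * qHermite (2 * k) x q) \<and>
         f_R x \<beta> q =
           f_N x q * (\<Sum>k. \<beta> ^ k / (qfact q k * qpoch (\<beta> * q) q k) * qHermite (2 * k) x q)"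
proof -
  note q = assms(1) and b = assms(2)
  have y: "\<bar>sqrt (1 - q) * x\<bar> < 2"
    using assms(1,3) by (simp add: abs_mult field_simps)
  let ?N = "\<lambda>k. (1 + q ^ k)\<^sup>2 - (1 - q) * x\<^sup>2 * q ^ k"
    and ?D = "\<lambda>k. (1 + \<beta> * q ^ k)\<^sup>2 - (1 - q) * \<beta> * x\<^sup>2 * q ^ k"
  \<comment> \<open>Stated for all \<open>a\<close>: the value 1 gives the numerators of the density
    products, the value \<open>\<beta>\<close> the denominators.\<close>
  have conv: "convergent_prod (\<lambda>k. (1 + a * q ^ k)\<^sup>2 - (1 - q) * a * x\<^sup>2 * q ^ k)" for a
    using convergent_prod_one_plus_quadratic_power[OF q, of "2 * a - (1 - q) * a * x\<^sup>2" "a\<^sup>2"]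
    by (rule back_subst[where P = convergent_prod])
      (simp add: fun_eq_iff power2_eq_square algebra_simps)
  have convN: "convergent_prod ?N" using conv[of 1] by simp
  have D_nz: "?D k \<noteq> 0" for k
    using kernel_factor_pos[OF q y, of "\<beta> * q ^ k"] abs_mult_power_less_1[OF b q, of k]
    by (simp add: abs_less_iff mult_ac)
  have nz: "prodinf ?D \<noteq> 0" "qpoch_inf \<beta> q \<noteq> 0" "qpoch_inf (\<beta> * q) q \<noteq> 0"
    using prodinf_nonzero[OF conv D_nz] qpoch_inf_neq_0[OF b q] qpoch_inf_neq_0[of "\<beta> * q" q]
      abs_mult_power_less_1[OF b q, of 1] q by auto
  have sum_eq: "suminf (kernel_term x q \<beta>) =
      qpoch_inf (\<beta>\<^sup>2) q / (qpoch_inf \<beta> q * qpoch_inf (\<beta> * q) q * prodinf ?D)"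
    using kernel_sum_product_formula[OF q y b conv] nz by (simp add: eq_divide_eq mult_ac)
  \<comment> \<open>The product of quotients splits into a quotient of convergent products; the
    factors missing from \<open>f_N\<close> are exactly those in \<open>sum_eq\<close>.\<close>
  have "f_R x \<beta> q = f_N x q * suminf (kernel_term x q \<beta>)"
    unfolding f_R_def f_N_def sum_eq prodinf_divide[OF convN conv, symmetric]
    by (simp add: mult_ac)
  then show ?thesis
    unfolding kernel_term_eq[OF q] using summable_kernel_term[OF q y b] by blast
qed

end
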